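(* Assume $g^\tau(\mathbf v)\Sigma(\mathbf v)g(\mathbf v)>0$. Then, as $n\to\infty$, $$\sqrt n\left(\hat\theta_n^\sharp-\theta\right)\left[g^\tau(\mathbf v)\Sigma(\mathbf v)g(\mathbf v)\right]^{-1/2}\stackrel{L}{\rightarrow}N(0,1),$$ where $$\hat\theta_n^\sharp=w_0+\sum_{k=1}^K\hat p_k\sum_{v=1}^{n-x_k}w_v\prod_{j=1}^v\left(1-\frac{x_k-1}{n-j}\right).$$
   Context: Let $\mathbf p=(p_1,\dots,p_K)$ be a probability distribution on letters $\ell_1,\dots,\ell_K$ with $K<\infty$ and $p_k>0$ for $k=1,\dots,K$. Let $\{w_v;v\ge0\}$ be real weights for which there is $M>0$ with $|w_v|\le M$ for all $v\ge0$. Put $h(t)=\sum_{v=0}^\infty w_v(1-t)^v$ for $t\in(0,1]$ and $h(0)=0$, and $$\theta=\sum_{v=0}^\infty w_v\sum_{k=1}^Kp_k(1-p_k)^v=\sum_{k=1}^Kp_kh(p_k).$$ Let $X_1,X_2,\dots$ be i.i.d. with $P(X_1=\ell_k)=p_k$. For a sample of size $n$ let $x_k=\sum_{i=1}^n1[X_i=\ell_k]$ and $\hat p_k=x_k/n$. In $\hat\theta_n^\sharp$, the $k$-th summand is $0$ when $x_k=0$. Let $\mathbf v=(p_1,\dots,p_{K-1})^\tau$ ($\tau$ denotes transpose), and let $\Sigma(\mathbf v)$ be the $(K-1)\times(K-1)$ matrix with diagonal entries $p_i(1-p_i)$ and off-diagonal entries $-p_ip_j$. Let $$G(\mathbf v)=\sum_{k=1}^{K-1}p_kh(p_k)+\Big(1-\sum_{k=1}^{K-1}p_k\Big)h\Big(1-\sum_{k=1}^{K-1}p_k\Big)$$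 and $g(\mathbf v)=\nabla G(\mathbf v)$; thus, with $p_K=1-\sum_{k=1}^{K-1}p_k$, the $j$-th component of $g(\mathbf v)$ is $h(p_j)+p_jh'(p_j)-h(p_K)-p_Kh'(p_K)$. $\stackrel{L}{\rightarrow}$ denotes convergence in law. *)

theory Defs
  imports "HOL-Probability.Probability"
begin

definition h_fun :: "(nat \<Rightarrow> real) \<Rightarrow> real \<Rightarrow> real" where
  "h_fun w t = (if 0 < t \<and> t \<le> 1 then (\<Sum>v. w v * (1 - t) ^ v) else 0)"

definition theta :: "(nat \<Rightarrow> real) \<Rightarrow> nat \<Rightarrow> (nat \<Rightarrow> real) \<Rightarrow> real" where
  "theta w K p = (\<Sum>v. w v * (\<Sum>k=1..K. p k * (1 - p k) ^ v))"

definition letter_count :: "(nat \<Rightarrow> 'b \<Rightarrow> 'a) \<Rightarrow> (nat \<Rightarrow> 'a) \<Rightarrow> nat \<Rightarrow> nat \<Rightarrow> 'b \<Rightarrow> nat" where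
  "letter_count X l n k \<omega> = (\<Sum>i=1..n. of_bool (X i \<omega> = l k))"

definition rel_freq :: "(nat \<Rightarrow> 'b \<Rightarrow> 'a) \<Rightarrow> (nat \<Rightarrow> 'a) \<Rightarrow> nat \<Rightarrow> nat \<Rightarrow> 'b \<Rightarrow> real" where
  "rel_freq X l n k \<omega> = real (letter_count X l n k \<omega>) / real n"

text \<open>For a count \<open>x \<ge> 1\<close> one has \<open>j \<le> n - x < n\<close> in the product below, so no
  denominator vanishes; a denominator can only vanish for \<open>x = 0\<close>, where the summand is
  \<open>0\<close> by convention.\<close>

definition theta_sharp ::
    "(nat \<Rightarrow> real) \<Rightarrow> nat \<Rightarrow> (nat \<Rightarrow> 'b \<Rightarrow> 'a) \<Rightarrow> (nat \<Rightarrow> 'a) \<Rightarrow> nat \<Rightarrow> 'b \<Rightarrow> real" where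
  "theta_sharp w K X l n \<omega> =
     w 0 + (\<Sum>k=1..K.
       let x = letter_count X l n k \<omega> in
       if x = 0 then 0
       else rel_freq X l n k \<omega> *
         (\<Sum>v=1..n-x. w v * (\<Prod>j=1..v. 1 - (real x - 1) / (real n - real j))))"

text \<open>A vector of \<open>\<real>\<^bsup>K-1\<^esup>\<close> is a function on \<open>nat\<close> of which only the coordinates
  \<open>1, \<dots>, K-1\<close> are used, and likewise for \<open>(K-1) \<times> (K-1)\<close> matrices.\<close>

definition G_fun :: "(nat \<Rightarrow> real) \<Rightarrow> nat \<Rightarrow> (nat \<Rightarrow> real) \<Rightarrow> real" where
  "G_fun w K v =
     (\<Sum>k=1..K-1. v k * h_fun w (v k))
     + (1 - (\<Sum>k=1..K-1. v k)) * h_fun w (1 - (\<Sum>k=1..K-1. v k))"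

definition partial_deriv :: "((nat \<Rightarrow> real) \<Rightarrow> real) \<Rightarrow> (nat \<Rightarrow> real) \<Rightarrow> nat \<Rightarrow> real" where
  "partial_deriv F v j = deriv (\<lambda>t. F (v(j := t))) (v j)"

definition g_grad :: "(nat \<Rightarrow> real) \<Rightarrow> nat \<Rightarrow> (nat \<Rightarrow> real) \<Rightarrow> nat \<Rightarrow> real" where
  "g_grad w K v j = partial_deriv (G_fun w K) v j"

lemma h_fun_differentiable:
  assumes bnd: "\<And>v. \<bar>w v\<bar> \<le> B" and t: "0 < t" "t < 1"
  shows "(h_fun w has_real_derivative deriv (h_fun w) t) (at t)"
proof -
  have summ: "summable (\<lambda>n. w n * z ^ n)" if "norm z < 1" for z :: real
  proof (rule summable_comparison_test')
    show "summable (\<lambda>n. B * \<bar>z\<bar> ^ n)"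
      using that by (intro summable_mult summable_geometric) auto
    show "norm (w n * z ^ n) \<le> B * \<bar>z\<bar> ^ n" if "n \<ge> 0" for n
      by (simp add: abs_mult power_abs mult_right_mono bnd)
  qed
  have "((\<lambda>z. \<Sum>n. w n * z ^ n) has_real_derivative (\<Sum>n. diffs w n * (1 - t) ^ n)) (at (1 - t))"
    by (rule termdiffs_strong'[of 1]) (use summ t in auto)
  moreover have "((\<lambda>s. 1 - s) has_real_derivative - 1) (at t)"
    by (auto intro!: derivative_eq_intros)
  ultimately have "((\<lambda>s. \<Sum>n. w n * (1 - s) ^ n) has_real_derivative
      (\<Sum>n. diffs w n * (1 - t) ^ n) * - 1) (at t)"
    by (rule DERIV_chain2)
  then have "(h_fun w has_real_derivative (\<Sum>n. diffs w n * (1 - t) ^ n) * - 1) (at t)"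
    by (rule has_field_derivative_transform_within_open[of _ _ _ "{0<..<1}"])
       (use t in \<open>auto simp: h_fun_def\<close>)
  then show ?thesis by (metis DERIV_imp_deriv)
qed

text \<open>The partial derivatives of \<open>G\<close> exist at every point of the open simplex, so that
  \<^const>\<open>deriv\<close> takes no unspecified value there.\<close>

lemma g_grad_eq:
  assumes bnd: "\<And>v. \<bar>w v\<bar> \<le> B" and j: "j \<in> {1..K-1}"
    and pos: "\<And>k. k \<in> {1..K} \<Longrightarrow> p k > 0" and one: "(\<Sum>k=1..K. p k) = 1"
  shows "g_grad w K (restrict p {1..K-1}) j =
      h_fun w (p j) + p j * deriv (h_fun w) (p j) - h_fun w (p K) - p K * deriv (h_fun w) (p K)"
proof -
  define v where "v = restrict p {1..K-1}"
  define A where "A = (\<Sum>k\<in>{1..K-1} - {j}. v k * h_fun w (v k))"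
  define c where "c = (\<Sum>k\<in>{1..K-1} - {j}. v k)"
  have vj: "v j = p j" using j by (simp add: v_def)
  have K: "{1..K} = insert K {1..K-1}" "K \<ge> 2" using j by auto
  have "(\<Sum>k=1..K-1. v k) = v j + c"
    unfolding c_def using j by (subst sum.remove[of _ j]) auto
  moreover have "(\<Sum>k=1..K-1. v k) = (\<Sum>k=1..K-1. p k)" by (simp add: v_def)
  moreover have "(\<Sum>k=1..K. p k) = p K + (\<Sum>k=1..K-1. p k)"
    unfolding K(1) using K(2) by (subst sum.insert) auto
  ultimately have pK: "p K = 1 - (p j + c)" using one vj by simp
  have c0: "c \<ge> 0" unfolding c_def v_def by (intro sum_nonneg) (use pos in \<open>force intro: less_imp_le\<close>)
  have "p j > 0" "p K > 0" using pos j K(2) by auto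
  with pK c0 have lt: "0 < p j" "p j < 1" "0 < p K" "p K < 1" by auto
  have eq: "G_fun w K (v(j := t)) = t * h_fun w t + A + (1 - (t + c)) * h_fun w (1 - (t + c))" for t
  proof -
    have "(\<Sum>k=1..K-1. f ((v(j := t)) k)) = f t + (\<Sum>k\<in>{1..K-1} - {j}. f (v k))" for f :: "real \<Rightarrow> real"
      using j by (subst sum.remove[of _ j]) (auto intro!: sum.cong)
    from this[of "\<lambda>x. x * h_fun w x"] this[of "\<lambda>x. x"] show ?thesis
      by (simp add: G_fun_def A_def c_def)
  qed
  have d1: "(h_fun w has_real_derivative deriv (h_fun w) (p j)) (at (p j))"
    using bnd lt by (intro h_fun_differentiable[of w B])
  have d2: "((\<lambda>t. h_fun w (1 - (t + c))) has_real_derivative deriv (h_fun w) (p K) * (-1)) (at (p j))"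
    by (rule DERIV_chain2[where f = "h_fun w" and g = "\<lambda>t. 1 - (t + c)"])
       (use h_fun_differentiable[of w B "p K"] bnd lt pK in
         \<open>auto intro!: derivative_eq_intros\<close>)
  have "((\<lambda>t. t * h_fun w t + A + (1 - (t + c)) * h_fun w (1 - (t + c))) has_real_derivative
      h_fun w (p j) + p j * deriv (h_fun w) (p j) - h_fun w (p K) - p K * deriv (h_fun w) (p K)) (at (p j))"
    by (rule derivative_eq_intros d1 d2 refl)+ (simp add: pK algebra_simps)
  then show ?thesis
    unfolding g_grad_def partial_deriv_def v_def[symmetric] eq vj by (rule DERIV_imp_deriv)
qed

definition Sigma_mat :: "(nat \<Rightarrow> real) \<Rightarrow> nat \<Rightarrow> nat \<Rightarrow> real" where
  "Sigma_mat v i j = (if i = j then v i * (1 - v i) else - (v i * v j))"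

definition quad_form :: "nat \<Rightarrow> (nat \<Rightarrow> real) \<Rightarrow> (nat \<Rightarrow> nat \<Rightarrow> real) \<Rightarrow> real" where
  "quad_form d a A = (\<Sum>i=1..d. \<Sum>j=1..d. a i * A i j * a j)"

definition asymp_var :: "(nat \<Rightarrow> real) \<Rightarrow> nat \<Rightarrow> (nat \<Rightarrow> real) \<Rightarrow> real" where
  "asymp_var w K v = quad_form (K - 1) (g_grad w K v) (Sigma_mat v)"

end

theory Submission imports Defs "HOL-Real_Asymp.Real_Asymp" begin

text \<open>
  On the event that \<open>x/n\<close> stays away from 0 and 1, each factor of the product in the estimator
  differs from \<open>1 - x/n\<close> by \<open>O(v/n)\<close>, uniformly, so the \<open>k\<close>-th summand is
  \<open>f (x/n) + O(1/n)\<close> with \<open>f t = t h(t)\<close>. Differentiability of \<open>f\<close> at \<open>p\<^sub>k\<close> and the variance bound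
  \<open>1/n\<close> for the relative frequencies make the estimator minus \<open>\<theta>\<close> equal to the linear statistic
  \<open>\<Sum>\<^sub>k f'(p\<^sub>k) (x\<^sub>k/n - p\<^sub>k)\<close> up to a remainder that is negligible at scale \<open>n\<^sup>-\<^sup>1\<^sup>/\<^sup>2\<close>. That
  statistic is a normalized sum of i.i.d. scores with variance
  \<open>\<Sum>\<^sub>k p\<^sub>k f'(p\<^sub>k)\<^sup>2 - (\<Sum>\<^sub>k p\<^sub>k f'(p\<^sub>k))\<^sup>2\<close>, which is the quadratic form
  of the theorem because variance is invariant under subtracting \<open>f'(p\<^sub>K)\<close> from every score.
\<close>

section \<open>Deterministic analysis: one summand of the estimator as a function of the
  count\<close>

lemma summable_bounded_coeff_power:
  fixes w :: "nat \<Rightarrow> real"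
  assumes "\<And>v. \<bar>w v\<bar> \<le> B" "\<bar>z\<bar> < 1"
  shows "summable (\<lambda>v. w v * z ^ v)"
proof (rule summable_comparison_test')
  show "summable (\<lambda>v. B * \<bar>z\<bar> ^ v)"
    using assms by (intro summable_mult summable_geometric) auto
  show "norm (w v * z ^ v) \<le> B * \<bar>z\<bar> ^ v" for v
    by (simp add: abs_mult power_abs mult_right_mono assms)
qed

text \<open>The quadratic weight changes consecutive ratios only by a factor tending to 1, so for
  large \<open>v\<close> they stay below any \<open>s\<close> strictly between \<open>r\<close> and
  1. These terms will dominate the termwise error of a summand.\<close>

lemma summable_square_times_power:
  fixes r :: real
  assumes "0 \<le> r" "r < 1"
  shows "summable (\<lambda>v. real v ^ 2 * r ^ v)"
proof (cases "r = 0")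
  case True
  then show ?thesis
    by (intro summable_finite[of "{0}"]) auto
next
  case False
  with assms have r: "0 < r" by simp
  define s where "s = (1 + r) / 2"
  have s: "r < s" "s < 1" using assms by (auto simp: s_def)
  have "(\<lambda>v. (real v + 1) ^ 2 / real v ^ 2 * r) \<longlonglongrightarrow> 1 * r"
    by (intro tendsto_mult tendsto_const) real_asymp
  then have "eventually (\<lambda>v. (real v + 1) ^ 2 / real v ^ 2 * r < s) sequentially"
    using s by (intro order_tendstoD) auto
  then obtain N where N: "\<And>v. v \<ge> N \<Longrightarrow> (real v + 1) ^ 2 / real v ^ 2 * r < s"
    by (auto simp: eventually_sequentially)
  show ?thesis
  proof (rule summable_ratio_test[OF s(2)])
    \<comment> \<open>Starting at \<open>Suc N\<close> keeps \<open>v\<close> positive, so the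
      quotient bound can be cleared of \<open>real v ^ 2\<close>.\<close>
    fix v assume v: "v \<ge> Suc N"
    then have "(real v + 1) ^ 2 * r \<le> s * real v ^ 2"
      using N[of v] by (simp add: field_simps)
    then have "(real v + 1) ^ 2 * r * r ^ v \<le> s * real v ^ 2 * r ^ v"
      using r by (intro mult_right_mono) auto
    then show "norm (real (Suc v) ^ 2 * r ^ Suc v) \<le> s * norm (real v ^ 2 * r ^ v)"
      using r by (simp add: abs_mult add.commute mult_ac)
  qed
qed

text \<open>After division by \<open>r\<close> all factors lie in [0, 1], where two products differ
  by at most the sum of the differences of their factors. Scaling back keeps the factor
  \<open>r ^ v\<close>, which makes the bound summable in \<open>v\<close>.\<close>

lemma prod_minus_power_le:
  fixes a :: "nat \<Rightarrow> real"
  assumes a: "\<And>j. j \<in> {1..v} \<Longrightarrow> 0 \<le> a j \<and> a j \<le> r" and b: "0 \<le> b" "b \<le> r" and r: "0 < r"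
    and d: "\<And>j. j \<in> {1..v} \<Longrightarrow> \<bar>a j - b\<bar> \<le> d"
  shows "\<bar>(\<Prod>j=1..v. a j) - b ^ v\<bar> \<le> r ^ v * (real v * (d / r))"
proof -
  have "norm ((\<Prod>j=1..v. a j / r) - (\<Prod>j=1..v. b / r)) \<le> (\<Sum>j=1..v. norm (a j / r - b / r))"
    by (rule norm_prod_diff) (use a b r in \<open>auto simp: divide_le_eq\<close>)
  also have "\<dots> \<le> (\<Sum>j=1..v. d / r)"
    using d r by (intro sum_mono) (auto simp: diff_divide_distrib[symmetric] intro!: divide_right_mono)
  also have "\<dots> = real v * (d / r)" by simp
  finally have "r ^ v * \<bar>(\<Prod>j=1..v. a j / r) - (\<Prod>j=1..v. b / r)\<bar> \<le> r ^ v * (real v * (d / r))"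
    using r by (intro mult_left_mono) auto
  moreover have "(\<Prod>j=1..v. a j) - b ^ v = r ^ v * ((\<Prod>j=1..v. a j / r) - (\<Prod>j=1..v. b / r))"
    using r by (simp add: prod_dividef power_divide field_simps)
  ultimately show ?thesis
    using r by (simp add: abs_mult)
qed

text \<open>The constant \<open>w 0\<close> of the estimator is distributed over the letters, since the relative
  frequencies sum to 1.\<close>

definition sharp_summand :: "(nat \<Rightarrow> real) \<Rightarrow> nat \<Rightarrow> nat \<Rightarrow> real" where
  "sharp_summand w n x = (if x = 0 then 0 else real x / real n *
     (w 0 + (\<Sum>v=1..n-x. w v * (\<Prod>j=1..v. 1 - (real x - 1) / (real n - real j)))))"

text \<open>Each factor is within O(v/n) of \<open>1 - x/n\<close>, and the number of factors
  contributes one more power of \<open>v\<close>. The condition \<open>2 / c <= n\<close> pays for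
  the \<open>- 1\<close> in the numerator: it costs at most \<open>c / 2\<close>, hence the common
  bound \<open>r\<close> on the factors.\<close>

lemma sharp_product_close:
  fixes c :: real and n x :: nat
  assumes c: "0 < c" "c < 1" and n: "2 / c \<le> n" and x: "c * n \<le> x" and v: "v \<le> n - x" "0 < v" and xn: "x \<le> n"
  defines "r \<equiv> 1 - c / 2"
  shows "\<bar>(\<Prod>j=1..v. 1 - (real x - 1) / (real n - real j)) - (1 - real x / real n) ^ v\<bar>
    \<le> 2 * (1 / c + 1) * (real v ^ 2 * r ^ v) / n"
proof -
  have r: "1/2 \<le> r" "r < 1" using c by (auto simp: r_def)
  have npos: "real n > 0" using n c by (smt (verit) divide_pos_pos)
  then have x0: "real x > 0" using x c by (smt (verit) mult_pos_pos)
  then have x1: "real x \<ge> 1" by simp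
  have cn: "1 / n \<le> c / 2" using n c npos by (simp add: field_simps)
  have q: "c \<le> real x / n" "real x / n \<le> 1" using x npos xn by (auto simp: field_simps)
  have "\<bar>(\<Prod>j=1..v. 1 - (real x - 1) / (real n - real j)) - (1 - real x / real n) ^ v\<bar>
      \<le> r ^ v * (real v * ((1 / c + 1) * v / n / r))"
  proof (rule prod_minus_power_le)
    fix j assume j: "j \<in> {1..v}"
    then have jv: "real j \<le> real v" "real j \<ge> 1" "real v \<ge> 1" by auto
    \<comment> \<open>As \<open>j <= v <= n - x\<close>, every denominator is at least
      \<open>x\<close>, hence positive.\<close>
    have "j + x \<le> n" using j v xn by auto
    then have nj: "real n - real j \<ge> real x" by linarith
    have "(real x - 1) / real n \<le> (real x - 1) / (real n - real j)"
      using nj x1 x0 jv by (intro divide_left_mono mult_pos_pos) auto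
    moreover have "(real x - 1) / real n = real x / n - 1 / n" by (simp add: diff_divide_distrib)
    ultimately have "1 - (real x - 1) / (real n - real j) \<le> r"
      using q cn unfolding r_def by linarith
    moreover have "(real x - 1) / (real n - real j) \<le> 1"
      using nj x0 by (auto simp: divide_le_eq)
    ultimately show "0 \<le> 1 - (real x - 1) / (real n - real j) \<and> 1 - (real x - 1) / (real n - real j) \<le> r"
      by simp
    have "(1 - (real x - 1) / (real n - real j)) - (1 - real x / n) =
        (real n - real x * real j) / (real n * (real n - real j))"
      using nj x0 npos by (simp add: field_simps)
    also have "\<bar>\<dots>\<bar> = \<bar>real n - real x * real j\<bar> / (real n * (real n - real j))"
      using nj x0 npos by (simp add: abs_mult)
    \<comment> \<open>Triangle inequality above, \<open>n - j >= x\<close> below.\<close>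
    also have "\<dots> \<le> (real n + real x * real j) / (real n * real x)"
      using nj x0 npos by (intro frac_le mult_left_mono) (auto simp: abs_le_iff)
    also have "\<dots> = 1 / x + j / n"
      using x0 npos by (simp add: field_simps)
    \<comment> \<open>Because \<open>v >= 1\<close>, the term \<open>1/x\<close> is also at most a
      multiple of \<open>v/n\<close>, so one bound linear in \<open>v\<close> covers both
      terms.\<close>
    also have "1 / real x \<le> v / (c * n)"
      using x jv c npos x0 by (intro frac_le) auto
    also have "j / real n \<le> v / n" using jv by (intro divide_right_mono) auto
    finally show "\<bar>1 - (real x - 1) / (real n - real j) - (1 - real x / n)\<bar> \<le> (1 / c + 1) * v / n"
      using c npos by (simp add: field_simps)
  next
    show "0 \<le> 1 - real x / n" "1 - real x / n \<le> r" "0 < r" using q r c unfolding r_def by linarith+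
  qed
  also have "\<dots> = (1 / c + 1) * (real v ^ 2 * r ^ v) / n * (1 / r)"
    by (simp add: power2_eq_square)
  \<comment> \<open>\<open>r >= 1/2\<close> since \<open>c < 1\<close>, so \<open>1 / r\<close>
    costs at most the factor 2.\<close>
  also have "\<dots> \<le> (1 / c + 1) * (real v ^ 2 * r ^ v) / n * 2"
    using r c npos by (intro mult_left_mono) (auto simp: field_simps)
  finally show ?thesis by (simp only: times_divide_eq_left times_divide_eq_right mult_ac)
qed

text \<open>The finite sum is read as a series with zeros after \<open>n - x\<close> and compared
  termwise with the power series defining \<open>h_fun w\<close>. Keeping \<open>x/n\<close> in
  [c, 1 - c] gives one dominating sequence, a multiple of \<open>v^2 r^v / n\<close>, for the
  retained terms and the tail alike.\<close>

lemma sharp_summand_close: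
  fixes c :: real
  assumes bnd: "\<And>v. \<bar>w v\<bar> \<le> B" and c: "0 < c" "c < 1"
  obtains C where "\<And>n x. 2 / c \<le> real n \<Longrightarrow> c * n \<le> real x \<Longrightarrow> real x \<le> (1 - c) * n \<Longrightarrow>
    \<bar>sharp_summand w n x - real x / n * h_fun w (real x / n)\<bar> \<le> C / n"
proof
  define r where "r = 1 - c / 2"
  define C where "C = B * (2 * (1 / c + 1))"
  have r: "0 < r" "r < 1" using c by (auto simp: r_def)
  have summ: "summable (\<lambda>v. real v ^ 2 * r ^ v)"
    using r by (intro summable_square_times_power) auto
  fix n x :: nat
  assume n: "2 / c \<le> n" and x: "c * n \<le> real x" "x \<le> (1 - c) * n"
  have npos: "real n > 0" using n c by (smt (verit) divide_pos_pos)
  then have x0: "real x > 0" using x c by (smt (verit) mult_pos_pos)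
  have "(1 - c) * real n \<le> 1 * real n" using c by (intro mult_right_mono) auto
  then have xn: "x \<le> n" using x by linarith
  define q where "q = real x / n"
  have q: "c \<le> q" "q \<le> 1 - c" "0 < q" "q < 1"
  proof -
    show "c \<le> q" "q \<le> 1 - c" using x npos by (auto simp: q_def field_simps)
    then show "0 < q" "q < 1" using c by linarith+
  qed
  define P where "P v = (\<Prod>j=1..v. 1 - (real x - 1) / (real n - real j))" for v
  \<comment> \<open>Index 0 is included: \<open>P 0\<close> is an empty product, so the series
    starts with \<open>w 0\<close>.\<close>
  define T where "T v = (if v \<in> {0..n-x} then w v * P v else 0)" for v
  have B: "B \<ge> 0" using bnd[of 0] by linarith
  have bound: "\<bar>T v - w v * (1 - q) ^ v\<bar> \<le> C * (real v ^ 2 * r ^ v) / n" for v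
  proof (cases "v \<in> {0..n-x}")
    case True
    then have v: "v \<le> n - x" by simp
    show ?thesis
    proof (cases "v = 0")
      case True
      then show ?thesis by (simp add: T_def P_def)
    next
      case False
      have "\<bar>T v - w v * (1 - q) ^ v\<bar> = \<bar>w v\<bar> * \<bar>P v - (1 - q) ^ v\<bar>"
        using True by (simp add: T_def right_diff_distrib[symmetric] abs_mult)
      also have "\<dots> \<le> B * (2 * (1 / c + 1) * (real v ^ 2 * r ^ v) / n)"
        unfolding P_def q_def r_def
        by (intro mult_mono sharp_product_close bnd) (use c n x v False xn B in auto)
      finally show ?thesis by (simp add: C_def mult_ac)
    qed
  next
    case False
    \<comment> \<open>Past the cutoff only the power series is left. There
      \<open>v > n - x >= c * n\<close>, so \<open>v^2 / (c * n) >= 1\<close> and the tail fits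
      under the bound used for the retained terms.\<close>
    then have v: "real v > real n - real x" "v \<ge> 1" using xn by auto
    have "(1 - c) * n = n - c * n" by (simp add: algebra_simps)
    then have "c * n \<le> v" using v x by linarith
    then have "c * n * 1 \<le> real v * real v" using v by (intro mult_mono) auto
    then have "1 \<le> (1 / c) * real v ^ 2 / n"
      using c npos by (simp add: field_simps power2_eq_square)
    also have "\<dots> \<le> (2 * (1 / c + 1)) * real v ^ 2 / n"
      using c by (intro divide_right_mono mult_right_mono) (auto simp: field_simps)
    finally have one: "1 \<le> (2 * (1 / c + 1)) * real v ^ 2 / n" .
    have "\<bar>T v - w v * (1 - q) ^ v\<bar> = \<bar>w v\<bar> * (1 - q) ^ v"
      using False q by (auto simp: T_def abs_mult)
    also have "\<dots> \<le> B * (1 * r ^ v)"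
      using q B bnd c by (intro mult_mono) (auto simp: r_def intro!: power_mono)
    also have "\<dots> \<le> B * ((2 * (1 / c + 1)) * real v ^ 2 / n * r ^ v)"
      using B r one by (intro mult_left_mono mult_right_mono) auto
    finally show ?thesis by (simp add: C_def mult_ac)
  qed
  have sT: "T sums (\<Sum>v=0..n-x. w v * P v)"
    unfolding T_def by (intro sums_If_finite_set) auto
  have sh: "(\<lambda>v. w v * (1 - q) ^ v) sums h_fun w q"
    using summable_bounded_coeff_power[of w B "1 - q"] bnd q by (auto simp: h_fun_def summable_sums)
  have "norm (\<Sum>v. T v - w v * (1 - q) ^ v) \<le> (\<Sum>v. C * (real v ^ 2 * r ^ v) / n)"
    by (intro norm_suminf_le) (use bound summ in \<open>auto intro!: summable_mult summable_divide\<close>)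
  also have "\<dots> = (\<Sum>v. C * (real v ^ 2 * r ^ v)) / n"
    by (rule suminf_divide[OF summable_mult[OF summ]])
  also have "\<dots> = C * (\<Sum>v. real v ^ 2 * r ^ v) / n"
    by (subst suminf_mult[OF summ]) simp
  also have "(\<Sum>v. T v - w v * (1 - q) ^ v) = (\<Sum>v=0..n-x. w v * P v) - h_fun w q"
    using sums_unique[OF sums_diff[OF sT sh]] by simp
  also have "(\<Sum>v=0..n-x. w v * P v) = w 0 + (\<Sum>v=1..n-x. w v * P v)"
    by (subst sum.atLeast_Suc_atMost) (auto simp: P_def)
  finally have main: "\<bar>w 0 + (\<Sum>v=1..n-x. w v * P v) - h_fun w q\<bar> \<le> C * (\<Sum>v. real v ^ 2 * r ^ v) / n"
    by simp
  have "sharp_summand w n x - q * h_fun w q = q * (w 0 + (\<Sum>v=1..n-x. w v * P v) - h_fun w q)"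
    using x0 by (simp add: sharp_summand_def P_def q_def right_diff_distrib)
  also have "\<bar>\<dots>\<bar> \<le> 1 * \<bar>w 0 + (\<Sum>v=1..n-x. w v * P v) - h_fun w q\<bar>"
    unfolding abs_mult using q by (intro mult_right_mono) auto
  also have "\<dots> \<le> C * (\<Sum>v. real v ^ 2 * r ^ v) / n" using main by simp
  finally show "\<bar>sharp_summand w n x - real x / n * h_fun w (real x / n)\<bar>
      \<le> C * (\<Sum>v. real v ^ 2 * r ^ v) / n"
    unfolding q_def .
qed

text \<open>For bounded \<open>w\<close> this is the derivative of \<open>t * h_fun w t\<close> on
  the open unit interval; by \<open>g_grad_eq\<close> the gradient components are differences of its
  values.\<close>

definition influence :: "(nat \<Rightarrow> real) \<Rightarrow> real \<Rightarrow> real" where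
  "influence w t = h_fun w t + t * deriv (h_fun w) t"

text \<open>The first-order expansion of \<open>t * h_fun w t\<close> at \<open>p\<close> supplies
  the term with \<open>e\<close>, the bound of \<open>sharp_summand_close\<close> the term
  \<open>C / n\<close>.\<close>

lemma sharp_summand_linearization:
  assumes bnd: "\<And>v. \<bar>w v\<bar> \<le> B" and p: "0 < p" "p < 1" and e: "0 < e"
  obtains d C N where "d > 0" "C \<ge> 0" "\<And>n x. n \<ge> N \<Longrightarrow> \<bar>real x / n - p\<bar> < d \<Longrightarrow>
    \<bar>sharp_summand w n x - p * h_fun w p - influence w p * (real x / n - p)\<bar>
      \<le> e * \<bar>real x / n - p\<bar> + C / n"
proof -
  have "((\<lambda>t. t * h_fun w t) has_real_derivative influence w p) (at p)"
    unfolding influence_def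
    by (rule derivative_eq_intros h_fun_differentiable[of w B p] bnd p refl)+ simp
  then have "((\<lambda>t. t * h_fun w t) has_derivative (*) (influence w p)) (at p)"
    by (simp add: has_field_derivative_def)
  then obtain d0 where d0: "d0 > 0" "\<And>t. \<bar>t - p\<bar> < d0 \<Longrightarrow>
      \<bar>t * h_fun w t - p * h_fun w p - influence w p * (t - p)\<bar> \<le> e * \<bar>t - p\<bar>"
    using e unfolding has_derivative_at_alt by force
  \<comment> \<open>\<open>2 * c\<close> is the distance from \<open>p\<close> to the nearer
    endpoint, so a deviation below \<open>c\<close> leaves \<open>x/n\<close> in [c, 1 - c].\<close>
  define c where "c = min p (1 - p) / 2"
  have c: "0 < c" "c < 1" "2 * c \<le> p" "p \<le> 1 - 2 * c" using p by (auto simp: c_def min_def)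
  obtain C where C: "\<And>n x. 2 / c \<le> real n \<Longrightarrow> c * n \<le> real x \<Longrightarrow> real x \<le> (1 - c) * n \<Longrightarrow>
      \<bar>sharp_summand w n x - real x / n * h_fun w (real x / n)\<bar> \<le> C / n"
    using sharp_summand_close[of w B c] bnd c by blast
  show thesis
  proof
    \<comment> \<open>\<open>sharp_summand_close\<close> fixes no sign for its constant, hence the
      \<open>max\<close>.\<close>
    show "min d0 c > 0" "max C 0 \<ge> 0" using d0 c by auto
    fix n x :: nat
    assume n: "n \<ge> nat \<lceil>2 / c\<rceil>" and x: "\<bar>real x / n - p\<bar> < min d0 c"
    from n have n': "2 / c \<le> real n" by linarith
    then have npos: "real n > 0" using c by (smt (verit) divide_pos_pos)
    have "c \<le> real x / n" "real x / n \<le> 1 - c" using x c by linarith+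
    then have "c * n \<le> real x" "real x \<le> (1 - c) * n" using npos by (auto simp: field_simps)
    moreover have "\<bar>real x / n - p\<bar> < d0" using x by simp
    ultimately have "\<bar>sharp_summand w n x - p * h_fun w p - influence w p * (real x / n - p)\<bar>
      \<le> e * \<bar>real x / n - p\<bar> + C / n"
      using C[OF n'] d0(2) by (smt (verit))
    moreover have "C / n \<le> max C 0 / n" by (intro divide_right_mono) auto
    ultimately show "\<bar>sharp_summand w n x - p * h_fun w p - influence w p * (real x / n - p)\<bar>
      \<le> e * \<bar>real x / n - p\<bar> + max C 0 / n" by linarith
  qed
qed

section \<open>The quadratic form as a variance of scores, and \<open>theta\<close> as a finite
  sum\<close>

lemma asymp_var_eq:
  assumes bnd: "\<And>v. \<bar>w v\<bar> \<le> B" and K: "K \<ge> 1"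
    and pos: "\<And>k. k \<in> {1..K} \<Longrightarrow> p k > 0" and one: "(\<Sum>k=1..K. p k) = 1"
  shows "asymp_var w K (restrict p {1..K-1}) =
    (\<Sum>k=1..K. p k * (influence w (p k)) ^ 2) - (\<Sum>k=1..K. p k * influence w (p k)) ^ 2"
proof -
  define a where "a k = influence w (p k)" for k
  define g where "g k = a k - a K" for k
  \<comment> \<open>The shifted scores \<open>g\<close> and their squares vanish at
    \<open>K\<close>, so including the last letter changes neither sum.\<close>
  have ext: "(\<Sum>k=1..K-1. p k * f k) = (\<Sum>k=1..K. p k * f k)" if "f K = 0" for f :: "nat \<Rightarrow> real"
  proof (rule sum.mono_neutral_left)
    show "\<forall>i\<in>{1..K} - {1..K - 1}. p i * f i = 0"
    proof
      fix i assume "i \<in> {1..K} - {1..K - 1}"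
      then have "i = K" by auto
      with that show "p i * f i = 0" by simp
    qed
  qed auto
  have "asymp_var w K (restrict p {1..K-1}) =
      (\<Sum>i=1..K-1. \<Sum>j=1..K-1. g i * (if i = j then p i * (1 - p i) else - (p i * p j)) * g j)"
    unfolding asymp_var_def quad_form_def Sigma_mat_def
  proof (intro sum.cong refl)
    fix i j assume ij: "i \<in> {1..K-1}" "j \<in> {1..K-1}"
    have "g_grad w K (restrict p {1..K-1}) k = g k" if "k \<in> {1..K-1}" for k
      using g_grad_eq[of w B k K p, OF bnd that pos one] by (simp add: g_def a_def influence_def)
    then show "g_grad w K (restrict p {1..K-1}) i *
        (if i = j then restrict p {1..K-1} i * (1 - restrict p {1..K-1} i)
          else - (restrict p {1..K-1} i * restrict p {1..K-1} j)) * g_grad w K (restrict p {1..K-1}) j =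
        g i * (if i = j then p i * (1 - p i) else - (p i * p j)) * g j"
      using ij by simp
  qed
  \<comment> \<open>The covariance matrix is diag(p) minus the rank-one matrix with entries
    \<open>p i * p j\<close>; the form becomes a second moment minus a squared mean.\<close>
  also have "\<dots> = (\<Sum>i=1..K-1. \<Sum>j=1..K-1. (if i = j then p i * g i ^ 2 else 0) - (p i * g i) * (p j * g j))"
    by (intro sum.cong refl) (auto simp: algebra_simps power2_eq_square)
  also have "\<dots> = (\<Sum>i=1..K-1. p i * g i ^ 2) - (\<Sum>i=1..K-1. p i * g i) ^ 2"
    by (simp add: sum_subtractf power2_eq_square sum_product)
  also have "\<dots> = (\<Sum>i=1..K. p i * g i ^ 2) - (\<Sum>i=1..K. p i * g i) ^ 2"
    by (subst (1 2) ext) (auto simp: g_def)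
  also have "(\<Sum>i=1..K. p i * g i ^ 2) =
      (\<Sum>i=1..K. p i * a i ^ 2 - 2 * a K * (p i * a i) + a K ^ 2 * p i)"
    by (intro sum.cong) (auto simp: g_def power2_eq_square algebra_simps)
  also have "\<dots> = (\<Sum>i=1..K. p i * a i ^ 2) - 2 * a K * (\<Sum>i=1..K. p i * a i) + a K ^ 2"
    by (simp add: sum.distrib sum_subtractf sum_distrib_left[symmetric] one[unfolded One_nat_def])
  also have "(\<Sum>i=1..K. p i * g i) = (\<Sum>i=1..K. p i * a i - a K * p i)"
    by (intro sum.cong) (auto simp: g_def algebra_simps)
  also have "\<dots> = (\<Sum>i=1..K. p i * a i) - a K"
    by (simp add: sum_subtractf sum_distrib_left[symmetric] one[unfolded One_nat_def])
  \<comment> \<open>All terms in \<open>a K\<close> cancel.\<close>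
  also have "(\<Sum>i=1..K. p i * a i ^ 2) - 2 * a K * (\<Sum>i=1..K. p i * a i) + a K ^ 2
      - ((\<Sum>i=1..K. p i * a i) - a K) ^ 2 = (\<Sum>i=1..K. p i * a i ^ 2) - (\<Sum>i=1..K. p i * a i) ^ 2"
    by (simp add: power2_eq_square algebra_simps)
  finally show ?thesis by (simp only: a_def)
qed

lemma theta_eq:
  assumes bnd: "\<And>v. \<bar>w v\<bar> \<le> B" and p: "\<And>k. k \<in> {1..K} \<Longrightarrow> 0 < p k \<and> p k < 1"
  shows "theta w K p = (\<Sum>k=1..K. p k * h_fun w (p k))"
proof -
  have s: "summable (\<lambda>v. w v * (1 - p k) ^ v)" if "k \<in> {1..K}" for k
    using p[OF that] bnd by (intro summable_bounded_coeff_power[of w B]) auto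
  have "theta w K p = (\<Sum>v. \<Sum>k=1..K. p k * (w v * (1 - p k) ^ v))"
    by (simp add: theta_def sum_distrib_left mult_ac)
  also have "\<dots> = (\<Sum>k=1..K. \<Sum>v. p k * (w v * (1 - p k) ^ v))"
    by (intro suminf_sum summable_mult s)
  also have "\<dots> = (\<Sum>k=1..K. p k * h_fun w (p k))"
    by (intro sum.cong refl) (use p s in \<open>auto simp: h_fun_def less_imp_le suminf_mult\<close>)
  finally show ?thesis .
qed

section \<open>Independence, negligible remainders and second moments on a probability space\<close>

context prob_space
begin

lemma integrable_bounded:
  fixes f :: "'a \<Rightarrow> real"
  assumes "f \<in> borel_measurable M" "\<And>x. x \<in> space M \<Longrightarrow> \<bar>f x\<bar> \<le> C"
  shows "integrable M f"
  by (rule integrable_const_bound[where B = C]) (use assms in auto)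

text \<open>The sample starts at index 1, whereas the central limit theorem takes a family over all
  naturals; reindexing along \<open>Suc\<close> will bridge the two.\<close>

lemma indep_sets_reindex:
  assumes ind: "indep_sets F (f ` I)" and inj: "inj_on f I"
  shows "indep_sets (F \<circ> f) I"
  unfolding indep_sets_def
proof (intro conjI ballI allI impI)
  fix i assume "i \<in> I"
  then show "(F \<circ> f) i \<subseteq> events" using ind by (auto simp: indep_sets_def)
next
  fix J A assume J: "J \<subseteq> I" "J \<noteq> {}" "finite J" and A: "A \<in> Pi J (F \<circ> f)"
  have injJ: "inj_on f J" using inj J(1) by (rule inj_on_subset)
  \<comment> \<open>Injectivity attaches each event unambiguously to the image of its index.\<close>
  define A' where "A' = A \<circ> inv_into J f"
  have A': "A' (f j) = A j" if "j \<in> J" for j using that injJ by (simp add: A'_def)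
  have "\<forall>j\<in>f ` J. A' j \<in> F j" using A A' by auto
  then have "prob (\<Inter>j\<in>f ` J. A' j) = (\<Prod>j\<in>f ` J. prob (A' j))"
    using ind J unfolding indep_sets_def by (meson Pi_I' finite_imageI image_is_empty image_mono)
  then show "prob (\<Inter> (A ` J)) = (\<Prod>j\<in>J. prob (A j))"
    using A' injJ by (simp add: prod.reindex)
qed

lemma indep_vars_reindex:
  assumes "indep_vars N X (f ` I)" "inj_on f I"
  shows "indep_vars (\<lambda>i. N (f i)) (\<lambda>i. X (f i)) I"
  unfolding indep_vars_def2
proof (intro conjI ballI)
  show "random_variable (N (f i)) (X (f i))" if "i \<in> I" for i
    using assms(1) that by (auto simp: indep_vars_def2)
  have "indep_sets (\<lambda>i. {X i -` A \<inter> space M |A. A \<in> sets (N i)}) (f ` I)"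
    using assms(1) by (simp add: indep_vars_def2)
  from indep_sets_reindex[OF this assms(2)]
  show "indep_sets (\<lambda>i. {X (f i) -` A \<inter> space M |A. A \<in> sets (N (f i))}) I"
    by (simp add: comp_def)
qed

text \<open>Convergence of the remainder to zero in probability enters in its truncated-mean form.\<close>

lemma weak_conv_m_add_negligible:
  fixes A R :: "nat \<Rightarrow> 'a \<Rightarrow> real"
  assumes [measurable]: "\<And>n. A n \<in> borel_measurable M" "\<And>n. R n \<in> borel_measurable M"
    and \<mu>: "real_distribution \<mu>" and conv: "weak_conv_m (\<lambda>n. distr M borel (A n)) \<mu>"
    and R: "(\<lambda>n. expectation (\<lambda>\<omega>. min 1 \<bar>R n \<omega>\<bar>)) \<longlonglongrightarrow> 0"
  shows "weak_conv_m (\<lambda>n. distr M borel (\<lambda>\<omega>. A n \<omega> + R n \<omega>)) \<mu>"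
proof (rule levy_continuity)
  show "real_distribution (distr M borel (\<lambda>\<omega>. A n \<omega> + R n \<omega>))" for n
    by (rule real_distribution_distr) measurable
  fix t :: real
  have A: "(\<lambda>n. char (distr M borel (A n)) t) \<longlonglongrightarrow> char \<mu> t"
    by (rule levy_continuity1[OF _ \<mu> conv]) (auto intro: real_distribution_distr)
  \<comment> \<open>\<open>|exp(itb) - 1|\<close> is at most \<open>|t| |b|\<close>, used for
    \<open>|b| <= 1\<close>, and at most 2, used beyond; \<open>T\<close> covers both.\<close>
  define T where "T = max \<bar>t\<bar> 2"
  have pw: "cmod (iexp (t * (a + b)) - iexp (t * a)) \<le> T * min 1 \<bar>b\<bar>" for a b :: real
  proof -
    have "iexp (t * (a + b)) - iexp (t * a) = iexp (t * a) * (iexp (t * b) - 1)"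
      by (simp add: algebra_simps exp_add[symmetric])
    then have eq: "cmod (iexp (t * (a + b)) - iexp (t * a)) = cmod (iexp (t * b) - 1)"
      by (simp add: norm_mult del: of_real_mult)
    have "cmod (iexp (t * b) - 1) \<le> \<bar>t * b\<bar>"
      using iexp_approx1[of "t * b" 0] by simp
    moreover have "\<bar>t * b\<bar> \<le> T * \<bar>b\<bar>"
      unfolding abs_mult T_def by (intro mult_right_mono) auto
    moreover have "cmod (iexp (t * b) - 1) \<le> 2"
      using norm_triangle_ineq4[of "iexp (t * b)" 1] by (simp del: of_real_mult)
    ultimately show ?thesis unfolding eq by (auto simp: T_def min_def)
  qed
  have int: "integrable M (\<lambda>\<omega>. iexp (t * f \<omega>))" if [measurable]: "f \<in> borel_measurable M" for f :: "'a \<Rightarrow> real"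
    by (rule integrable_const_bound[of _ 1]) (auto simp del: of_real_mult)
  have le: "cmod (char (distr M borel (\<lambda>\<omega>. A n \<omega> + R n \<omega>)) t - char (distr M borel (A n)) t)
      \<le> T * expectation (\<lambda>\<omega>. min 1 \<bar>R n \<omega>\<bar>)" for n
  proof -
    have "char (distr M borel (\<lambda>\<omega>. A n \<omega> + R n \<omega>)) t - char (distr M borel (A n)) t =
        (CLINT \<omega>|M. iexp (t * (A n \<omega> + R n \<omega>)) - iexp (t * A n \<omega>))"
      unfolding char_def by (subst (1 2) integral_distr) (auto intro!: Bochner_Integration.integral_diff[symmetric] int simp del: of_real_mult)
    also have "cmod \<dots> \<le> (LINT \<omega>|M. cmod (iexp (t * (A n \<omega> + R n \<omega>)) - iexp (t * A n \<omega>)))"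
      by (rule integral_norm_bound)
    also have "\<dots> \<le> (LINT \<omega>|M. T * min 1 \<bar>R n \<omega>\<bar>)"
      by (intro integral_mono pw integrable_norm Bochner_Integration.integrable_diff int
          integrable_mult_right integrable_bounded[of _ 1]) auto
    finally show ?thesis by simp
  qed
  have lim: "(\<lambda>n. T * expectation (\<lambda>\<omega>. min 1 \<bar>R n \<omega>\<bar>)) \<longlonglongrightarrow> 0"
    using tendsto_mult_left[OF R, of T] by simp
  have "(\<lambda>n. char (distr M borel (\<lambda>\<omega>. A n \<omega> + R n \<omega>)) t - char (distr M borel (A n)) t) \<longlonglongrightarrow> 0"
    by (rule Lim_null_comparison[OF always_eventually lim]) (use le in blast)
  from tendsto_add[OF this A] show "(\<lambda>n. char (distr M borel (\<lambda>\<omega>. A n \<omega> + R n \<omega>)) t) \<longlonglongrightarrow> char \<mu> t"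
    by simp
qed (fact \<mu>)

text \<open>The truncated absolute value is subadditive, so the truncated mean of a finite sum is at
  most the sum of the truncated means.\<close>

lemma truncated_mean_sum_tendsto_0:
  fixes R :: "'i \<Rightarrow> nat \<Rightarrow> 'a \<Rightarrow> real"
  assumes [measurable]: "\<And>i n. i \<in> I \<Longrightarrow> R i n \<in> borel_measurable M" and fin: "finite I"
    and R: "\<And>i. i \<in> I \<Longrightarrow> (\<lambda>n. expectation (\<lambda>\<omega>. min 1 \<bar>R i n \<omega>\<bar>)) \<longlonglongrightarrow> 0"
  shows "(\<lambda>n. expectation (\<lambda>\<omega>. min 1 \<bar>\<Sum>i\<in>I. R i n \<omega>\<bar>)) \<longlonglongrightarrow> 0"
proof (rule tendsto_sandwich[where f = "\<lambda>_. 0" and h = "\<lambda>n. \<Sum>i\<in>I. expectation (\<lambda>\<omega>. min 1 \<bar>R i n \<omega>\<bar>)"])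
  show "(\<lambda>n. \<Sum>i\<in>I. expectation (\<lambda>\<omega>. min 1 \<bar>R i n \<omega>\<bar>)) \<longlonglongrightarrow> 0"
    by (rule tendsto_null_sum) (rule R)
  have sub: "min 1 \<bar>\<Sum>i\<in>I. f i\<bar> \<le> (\<Sum>i\<in>I. min 1 \<bar>f i\<bar>)" for f :: "'i \<Rightarrow> real"
    using fin
  proof induction
    case (insert i J)
    have "min 1 \<bar>f i + s\<bar> \<le> min 1 \<bar>f i\<bar> + min 1 \<bar>s\<bar>" for s by (auto simp: min_def)
    from this[of "sum f J"] insert show ?case by auto
  qed simp
  have int: "integrable M (\<lambda>\<omega>. min 1 \<bar>f \<omega>\<bar>)" if [measurable]: "f \<in> borel_measurable M" for f :: "'a \<Rightarrow> real"
    by (rule integrable_bounded[of _ 1]) auto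
  have "expectation (\<lambda>\<omega>. min 1 \<bar>\<Sum>i\<in>I. R i n \<omega>\<bar>) \<le> expectation (\<lambda>\<omega>. \<Sum>i\<in>I. min 1 \<bar>R i n \<omega>\<bar>)" for n
    by (intro integral_mono sub int Bochner_Integration.integrable_sum borel_measurable_sum assms)
  also have "expectation (\<lambda>\<omega>. \<Sum>i\<in>I. min 1 \<bar>R i n \<omega>\<bar>) = (\<Sum>i\<in>I. expectation (\<lambda>\<omega>. min 1 \<bar>R i n \<omega>\<bar>))" for n
    by (intro Bochner_Integration.integral_sum int assms)
  finally show "eventually (\<lambda>n. expectation (\<lambda>\<omega>. min 1 \<bar>\<Sum>i\<in>I. R i n \<omega>\<bar>)
      \<le> (\<Sum>i\<in>I. expectation (\<lambda>\<omega>. min 1 \<bar>R i n \<omega>\<bar>))) sequentially"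
    by (intro always_eventually allI)
  show "eventually (\<lambda>n. 0 \<le> expectation (\<lambda>\<omega>. min 1 \<bar>\<Sum>i\<in>I. R i n \<omega>\<bar>)) sequentially"
    by (intro always_eventually allI Bochner_Integration.integral_nonneg) simp
qed simp

text \<open>Near 0 the local bound on \<open>R n\<close> applies; elsewhere the truncated value 1 is
  at most \<open>(D n / d)^2\<close>, a pointwise Chebyshev bound. Both cases are dominated by an
  affine function of \<open>(D n)^2\<close>, whose mean is controlled by \<open>mom\<close>.\<close>

lemma delta_method_remainder:
  fixes D R :: "nat \<Rightarrow> 'a \<Rightarrow> real"
  assumes [measurable]: "\<And>n. D n \<in> borel_measurable M" "\<And>n. R n \<in> borel_measurable M"
    and int: "\<And>n. integrable M (\<lambda>\<omega>. (D n \<omega>)\<^sup>2)"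
    and mom: "\<And>n. n \<ge> 1 \<Longrightarrow> expectation (\<lambda>\<omega>. (D n \<omega>)\<^sup>2) \<le> 1 / n"
    and R: "\<And>e. e > 0 \<Longrightarrow> \<exists>d>0. \<exists>C\<ge>0. \<exists>N. \<forall>n\<ge>N. \<forall>\<omega>\<in>space M. \<bar>D n \<omega>\<bar> < d \<longrightarrow>
      \<bar>R n \<omega>\<bar> \<le> e * \<bar>D n \<omega>\<bar> + C / n"
  shows "(\<lambda>n. expectation (\<lambda>\<omega>. min 1 \<bar>sqrt n * R n \<omega>\<bar>)) \<longlonglongrightarrow> 0"
proof (rule LIMSEQ_I)
  fix \<epsilon> :: real assume \<epsilon>: "\<epsilon> > 0"
  \<comment> \<open>The final bound is \<open>2 * e\<close> plus terms eventually below
    \<open>e\<close>, so a quarter suffices.\<close>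
  define e where "e = \<epsilon> / 4"
  have e: "e > 0" using \<epsilon> by (simp add: e_def)
  obtain d C N where d: "d > 0" "C \<ge> 0" and N: "\<And>n \<omega>. n \<ge> N \<Longrightarrow> \<omega> \<in> space M \<Longrightarrow> \<bar>D n \<omega>\<bar> < d \<Longrightarrow>
      \<bar>R n \<omega>\<bar> \<le> e * \<bar>D n \<omega>\<bar> + C / n"
    using R[OF e] by blast
  have bound: "expectation (\<lambda>\<omega>. min 1 \<bar>sqrt n * R n \<omega>\<bar>) \<le> 2 * e + C / sqrt n + 1 / (n * d\<^sup>2)"
    if n: "n \<ge> max N 1" for n
  proof -
    have npos: "real n > 0" using n by simp
    have "expectation (\<lambda>\<omega>. min 1 \<bar>sqrt n * R n \<omega>\<bar>) \<le>
        expectation (\<lambda>\<omega>. (e + C / sqrt n) + (e * n + 1 / d\<^sup>2) * (D n \<omega>)\<^sup>2)"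
    proof (rule integral_mono)
      show "integrable M (\<lambda>\<omega>. min 1 \<bar>sqrt n * R n \<omega>\<bar>)"
        by (rule integrable_bounded[of _ 1]) auto
      show "integrable M (\<lambda>\<omega>. (e + C / sqrt n) + (e * n + 1 / d\<^sup>2) * (D n \<omega>)\<^sup>2)"
        by (intro Bochner_Integration.integrable_add integrable_mult_right int) auto
      fix \<omega> assume \<omega>: "\<omega> \<in> space M"
      show "min 1 \<bar>sqrt n * R n \<omega>\<bar> \<le> (e + C / sqrt n) + (e * n + 1 / d\<^sup>2) * (D n \<omega>)\<^sup>2"
      proof (cases "\<bar>D n \<omega>\<bar> < d")
        case True
        \<comment> \<open>This trades the first moment for the second, the only one that is bounded
          by hypothesis.\<close>
        have amgm: "sqrt n * \<bar>D n \<omega>\<bar> \<le> 1 + n * (D n \<omega>)\<^sup>2"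
        proof -
          have "0 \<le> (sqrt n * \<bar>D n \<omega>\<bar> - 1)\<^sup>2" by simp
          also have "\<dots> = n * (D n \<omega>)\<^sup>2 - 2 * (sqrt n * \<bar>D n \<omega>\<bar>) + 1"
            by (simp add: power2_diff power_mult_distrib)
          finally show ?thesis by (smt (verit) mult_nonneg_nonneg real_sqrt_ge_zero of_nat_0_le_iff abs_ge_zero)
        qed
        have "\<bar>sqrt n * R n \<omega>\<bar> \<le> sqrt n * (e * \<bar>D n \<omega>\<bar> + C / n)"
          using N[of n \<omega>] n \<omega> True by (simp add: abs_mult mult_left_mono)
        also have "\<dots> = e * (sqrt n * \<bar>D n \<omega>\<bar>) + C / sqrt n"
          using npos by (simp add: field_simps)
        also have "\<dots> \<le> e * (1 + n * (D n \<omega>)\<^sup>2) + C / sqrt n"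
          using amgm e by (intro add_right_mono mult_left_mono) auto
        also have "\<dots> \<le> (e + C / sqrt n) + (e * n + 1 / d\<^sup>2) * (D n \<omega>)\<^sup>2"
          by (simp add: algebra_simps)
        finally show ?thesis by simp
      next
        case False
        then have "d\<^sup>2 \<le> (D n \<omega>)\<^sup>2" using d(1) abs_le_square_iff[of d "D n \<omega>"] by simp
        then have "1 \<le> 1 / d\<^sup>2 * (D n \<omega>)\<^sup>2" using d(1) by (simp add: field_simps)
        also have "\<dots> \<le> (e * n + 1 / d\<^sup>2) * (D n \<omega>)\<^sup>2"
          using e by (intro mult_right_mono) auto
        also have "\<dots> \<le> (e + C / sqrt n) + \<dots>" using e d by simp
        finally show ?thesis by simp
      qed
    qed
    also have "\<dots> = (e + C / sqrt n) + (e * n + 1 / d\<^sup>2) * expectation (\<lambda>\<omega>. (D n \<omega>)\<^sup>2)"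
      using int by (subst Bochner_Integration.integral_add) (auto simp: prob_space)
    also have "\<dots> \<le> (e + C / sqrt n) + (e * n + 1 / d\<^sup>2) * (1 / n)"
      using e mom[of n] n by (intro add_left_mono mult_left_mono) auto
    also have "\<dots> = 2 * e + C / sqrt n + 1 / (n * d\<^sup>2)"
      using npos by (simp add: field_simps)
    finally show ?thesis .
  qed
  have "(\<lambda>n. C / sqrt (real n) + 1 / (real n * d\<^sup>2)) \<longlonglongrightarrow> 0"
    using d(1) by real_asymp
  then have "eventually (\<lambda>n. C / sqrt (real n) + 1 / (real n * d\<^sup>2) < e) sequentially"
    using e by (intro order_tendstoD) auto
  then obtain N' where N': "\<And>n. n \<ge> N' \<Longrightarrow> C / sqrt (real n) + 1 / (real n * d\<^sup>2) < e"
    by (auto simp: eventually_sequentially)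
  have "norm (expectation (\<lambda>\<omega>. min 1 \<bar>sqrt n * R n \<omega>\<bar>) - 0) < \<epsilon>" if "n \<ge> max N' (max N 1)" for n
  proof -
    have "expectation (\<lambda>\<omega>. min 1 \<bar>sqrt n * R n \<omega>\<bar>) \<ge> 0" by (intro Bochner_Integration.integral_nonneg) auto
    moreover have "\<epsilon> = 4 * e" by (simp add: e_def)
    moreover have "C / sqrt n + 1 / (n * d\<^sup>2) < e" using N'[of n] that by simp
    moreover have "expectation (\<lambda>\<omega>. min 1 \<bar>sqrt n * R n \<omega>\<bar>) \<le> 2 * e + C / sqrt n + 1 / (n * d\<^sup>2)"
      using bound[of n] that by simp
    ultimately show ?thesis using e unfolding real_norm_def by linarith
  qed
  then show "\<exists>no. \<forall>n\<ge>no. norm (expectation (\<lambda>\<omega>. min 1 \<bar>sqrt n * R n \<omega>\<bar>) - 0) < \<epsilon>" by blast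
qed

text \<open>Cross terms vanish by independence and zero means; each diagonal term is at most
  1.\<close>

lemma expectation_indep_sum_square:
  fixes Z :: "nat \<Rightarrow> 'a \<Rightarrow> real"
  assumes ind: "indep_vars (\<lambda>_. borel) Z I" and fin: "finite I"
    and mean: "\<And>i. i \<in> I \<Longrightarrow> expectation (Z i) = 0"
    and bnd: "\<And>i \<omega>. i \<in> I \<Longrightarrow> \<omega> \<in> space M \<Longrightarrow> \<bar>Z i \<omega>\<bar> \<le> 1"
  shows "expectation (\<lambda>\<omega>. (\<Sum>i\<in>I. Z i \<omega>)\<^sup>2) \<le> card I"
proof -
  have [measurable]: "Z i \<in> borel_measurable M" if "i \<in> I" for i
    using ind that by (auto simp: indep_vars_def)
  have b: "\<bar>Z i \<omega> * Z j \<omega>\<bar> \<le> 1" if "i \<in> I" "j \<in> I" "\<omega> \<in> space M" for i j \<omega>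
    using bnd[of i \<omega>] bnd[of j \<omega>] that by (simp add: abs_mult mult_le_one)
  have int: "integrable M (\<lambda>\<omega>. Z i \<omega> * Z j \<omega>)" if "i \<in> I" "j \<in> I" for i j
    using that b by (intro integrable_bounded[of _ 1]) auto
  have intZ: "integrable M (Z i)" if "i \<in> I" for i
    using that bnd by (intro integrable_bounded[of _ 1]) auto
  have off: "expectation (\<lambda>\<omega>. Z i \<omega> * Z j \<omega>) = 0" if "i \<in> I" "j \<in> I" "i \<noteq> j" for i j
  proof -
    have "expectation (\<lambda>\<omega>. \<Prod>k\<in>{i, j}. Z k \<omega>) = (\<Prod>k\<in>{i, j}. expectation (Z k))"
      using that intZ by (intro indep_vars_lebesgue_integral indep_vars_subset[OF ind]) auto
    then show ?thesis using that mean by simp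
  qed
  have "expectation (\<lambda>\<omega>. (\<Sum>i\<in>I. Z i \<omega>)\<^sup>2) = expectation (\<lambda>\<omega>. \<Sum>i\<in>I. \<Sum>j\<in>I. Z i \<omega> * Z j \<omega>)"
    by (simp add: power2_eq_square sum_product)
  also have "\<dots> = (\<Sum>i\<in>I. \<Sum>j\<in>I. expectation (\<lambda>\<omega>. Z i \<omega> * Z j \<omega>))"
    using int by (simp add: Bochner_Integration.integral_sum Bochner_Integration.integrable_sum)
  also have "\<dots> = (\<Sum>i\<in>I. \<Sum>j\<in>I. if i = j then expectation (\<lambda>\<omega>. Z i \<omega> * Z i \<omega>) else 0)"
    by (intro sum.cong refl) (use off in auto)
  also have "\<dots> = (\<Sum>i\<in>I. expectation (\<lambda>\<omega>. Z i \<omega> * Z i \<omega>))"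
    using fin by simp
  also have "\<dots> \<le> (\<Sum>i\<in>I. 1)"
  proof (rule sum_mono)
    fix i assume i: "i \<in> I"
    have "expectation (\<lambda>\<omega>. Z i \<omega> * Z i \<omega>) \<le> expectation (\<lambda>\<omega>. 1)"
      using int b i by (intro integral_mono) (auto simp: abs_le_iff)
    then show "expectation (\<lambda>\<omega>. Z i \<omega> * Z i \<omega>) \<le> 1" by (simp add: prob_space)
  qed
  finally show ?thesis by simp
qed

text \<open>Every function on a counting space is measurable, and finiteness of the range bounds
  it.\<close>

lemma integrable_finite_range:
  fixes g :: "'c \<Rightarrow> real"
  assumes Y: "Y \<in> M \<rightarrow>\<^sub>M count_space S" and fin: "finite S"
  shows "integrable M (\<lambda>\<omega>. g (Y \<omega>))"
proof (rule integrable_bounded)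
  show "(\<lambda>\<omega>. g (Y \<omega>)) \<in> borel_measurable M"
    by (rule measurable_compose[OF Y]) simp
  fix \<omega> assume "\<omega> \<in> space M"
  then have "Y \<omega> \<in> S" using measurable_space[OF Y] by auto
  then show "\<bar>g (Y \<omega>)\<bar> \<le> (\<Sum>s\<in>S. \<bar>g s\<bar>)"
    using fin by (intro member_le_sum) auto
qed

lemma expectation_finite_range:
  fixes g :: "'c \<Rightarrow> real"
  assumes Y: "Y \<in> M \<rightarrow>\<^sub>M count_space S" and fin: "finite S"
  shows "expectation (\<lambda>\<omega>. g (Y \<omega>)) = (\<Sum>s\<in>S. prob {\<omega>\<in>space M. Y \<omega> = s} * g s)"
proof -
  have ev: "{\<omega>\<in>space M. Y \<omega> = s} \<in> events" if "s \<in> S" for s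
    using measurable_sets[OF Y, of "{s}"] that by (simp add: vimage_def Int_def conj_commute)
  have "expectation (\<lambda>\<omega>. g (Y \<omega>)) = expectation (\<lambda>\<omega>. \<Sum>s\<in>S. g s * indicator {\<omega>\<in>space M. Y \<omega> = s} \<omega>)"
  proof (rule Bochner_Integration.integral_cong[OF refl])
    fix \<omega> assume \<omega>: "\<omega> \<in> space M"
    then have "Y \<omega> \<in> S" using measurable_space[OF Y] by auto
    then show "g (Y \<omega>) = (\<Sum>s\<in>S. g s * indicator {\<omega>\<in>space M. Y \<omega> = s} \<omega>)"
      using fin \<omega> by (subst sum.remove[of _ "Y \<omega>"]) (auto simp: indicator_def intro!: sum.neutral)
  qed
  also have "\<dots> = (\<Sum>s\<in>S. g s * prob {\<omega>\<in>space M. Y \<omega> = s})"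
    using ev by (subst Bochner_Integration.integral_sum) (auto simp: less_top[symmetric])
  finally show ?thesis by (simp add: mult.commute)
qed

end

section \<open>Counts, relative frequencies and scores in a letter sample\<close>

lemma sum_of_bool_label:
  fixes f :: "'k \<Rightarrow> 'c::semiring_1"
  assumes "inj_on l A" "finite A" "k \<in> A"
  shows "(\<Sum>j\<in>A. of_bool (l k = l j) * f j) = f k"
proof -
  have "(\<Sum>j\<in>A. of_bool (l k = l j) * f j) = (\<Sum>j\<in>A. if j = k then f j else 0)"
    by (intro sum.cong refl) (use assms in \<open>auto simp: inj_on_def\<close>)
  then show ?thesis using assms by simp
qed

text \<open>\<open>K2\<close> keeps every \<open>p k\<close> strictly below 1, where
  \<open>h_fun w\<close> is differentiable; the theorem derives it from the positive
  variance.\<close>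

locale letter_sample = prob_space M
  for M :: "'b measure" +
  fixes X :: "nat \<Rightarrow> 'b \<Rightarrow> 'a" and l :: "nat \<Rightarrow> 'a" and p :: "nat \<Rightarrow> real" and K :: nat
  assumes inj: "inj_on l {1..K}"
    and pos: "\<And>k. k \<in> {1..K} \<Longrightarrow> p k > 0"
    and one: "(\<Sum>k=1..K. p k) = 1"
    and indep: "indep_vars (\<lambda>_. count_space (l ` {1..K})) X {1..}"
    and ident: "\<And>i. i \<ge> 1 \<Longrightarrow>
      distr M (count_space (l ` {1..K})) (X i) = distr M (count_space (l ` {1..K})) (X 1)"
    and prob1: "\<And>k. k \<in> {1..K} \<Longrightarrow> prob {\<omega> \<in> space M. X 1 \<omega> = l k} = p k"
    and K2: "K \<ge> 2"
begin

lemma p_less_1: "k \<in> {1..K} \<Longrightarrow> p k < 1"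
proof -
  assume k: "k \<in> {1..K}"
  define j where "j = (if k = 1 then 2 else 1 :: nat)"
  have j: "j \<in> {1..K} - {k}" using K2 by (auto simp: j_def)
  have "0 < p j" using pos j by auto
  also have "p j \<le> sum p ({1..K} - {k})"
    using pos j by (intro member_le_sum) (auto intro: less_imp_le)
  finally have "0 < sum p ({1..K} - {k})" .
  moreover have "sum p {1..K} = p k + sum p ({1..K} - {k})" using k by (subst sum.remove[of _ k]) auto
  ultimately show ?thesis using one by linarith
qed

lemma measurable_X: "i \<ge> 1 \<Longrightarrow> X i \<in> M \<rightarrow>\<^sub>M count_space (l ` {1..K})"
  using indep by (auto simp: indep_vars_def)

lemma measurable_fun_X:
  assumes "i \<ge> 1"
  shows "(\<lambda>\<omega>. g (X i \<omega>) :: 'c :: topological_space) \<in> borel_measurable M"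
  by (rule measurable_compose[OF measurable_X[OF assms]]) simp

lemma X_eq_label:
  assumes "i \<ge> 1" "\<omega> \<in> space M"
  obtains k where "k \<in> {1..K}" "X i \<omega> = l k"
  using measurable_space[OF measurable_X[OF assms(1)] assms(2)] by auto

text \<open>Point probabilities are given for \<open>X 1\<close> alone; \<open>ident\<close>
  transfers expectations to every other index.\<close>

lemma expectation_fun_X:
  fixes g :: "'a \<Rightarrow> real"
  assumes i: "i \<ge> 1"
  shows "expectation (\<lambda>\<omega>. g (X i \<omega>)) = (\<Sum>k=1..K. p k * g (l k))"
proof -
  let ?N = "count_space (l ` {1..K})"
  have eq: "expectation (\<lambda>\<omega>. g (X j \<omega>)) = (LINT s|distr M ?N (X j). g s)" if "j \<ge> 1" for j
    by (rule integral_distr[symmetric]) (use measurable_X that in auto)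
  have "expectation (\<lambda>\<omega>. g (X i \<omega>)) = expectation (\<lambda>\<omega>. g (X 1 \<omega>))"
    using eq[OF i] eq[of 1] ident[OF i] by simp
  also have "\<dots> = (\<Sum>s\<in>l ` {1..K}. prob {\<omega>\<in>space M. X 1 \<omega> = s} * g s)"
    by (rule expectation_finite_range[OF measurable_X]) auto
  also have "\<dots> = (\<Sum>k=1..K. prob {\<omega>\<in>space M. X 1 \<omega> = l k} * g (l k))"
    by (rule sum.reindex_cong[OF inj]) auto
  finally show ?thesis using prob1 by simp
qed

text \<open>Exchanging the sums turns a linear statistic of the counts into a sum of one score per
  observation, indexed from 0 as in the central limit theorem.\<close>

lemma sum_letter_count:
  fixes f :: "nat \<Rightarrow> real"
  assumes \<omega>: "\<omega> \<in> space M"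
  shows "(\<Sum>k=1..K. real (letter_count X l n k \<omega>) * f k) =
    (\<Sum>i<n. \<Sum>k=1..K. of_bool (X (Suc i) \<omega> = l k) * f k)"
proof -
  have "(\<Sum>i=1..n. F i) = (\<Sum>i<n. F (Suc i))" for F :: "nat \<Rightarrow> real"
    by (rule sum.reindex_bij_witness[of _ Suc "\<lambda>i. i - 1"]) auto
  then have "real (letter_count X l n k \<omega>) = (\<Sum>i<n. of_bool (X (Suc i) \<omega> = l k))" for k
    by (simp only: letter_count_def of_nat_sum of_nat_of_bool)
  then have "(\<Sum>k=1..K. real (letter_count X l n k \<omega>) * f k) =
      (\<Sum>k=1..K. \<Sum>i<n. of_bool (X (Suc i) \<omega> = l k) * f k)"
    by (simp only: sum_distrib_right)
  also have "\<dots> = (\<Sum>i<n. \<Sum>k=1..K. of_bool (X (Suc i) \<omega> = l k) * f k)"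
    by (rule sum.swap)
  finally show ?thesis .
qed

lemma sum_letter_count_eq:
  assumes \<omega>: "\<omega> \<in> space M"
  shows "(\<Sum>k=1..K. real (letter_count X l n k \<omega>)) = n"
proof -
  have "(\<Sum>k=1..K. of_bool (X (Suc i) \<omega> = l k) * 1 :: real) = 1" for i
  proof -
    obtain k where "k \<in> {1..K}" "X (Suc i) \<omega> = l k" using X_eq_label[of "Suc i" \<omega>] \<omega> by auto
    then show ?thesis using sum_of_bool_label[OF inj, of k "\<lambda>_. 1 :: real"] by simp
  qed
  then show ?thesis using sum_letter_count[OF \<omega>, of n "\<lambda>_. 1"] by simp
qed

text \<open>The case \<open>n = 0\<close> has to be excluded: the left side is then
  \<open>w 0\<close> and the right side 0.\<close>

lemma theta_sharp_eq:
  assumes \<omega>: "\<omega> \<in> space M" and n: "n \<ge> 1"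
  shows "theta_sharp w K X l n \<omega> = (\<Sum>k=1..K. sharp_summand w n (letter_count X l n k \<omega>))"
proof -
  let ?x = "\<lambda>k. letter_count X l n k \<omega>"
  let ?s = "\<lambda>k. if ?x k = 0 then 0 else real (?x k) / n *
      (\<Sum>v=1..n-?x k. w v * (\<Prod>j=1..v. 1 - (real (?x k) - 1) / (real n - real j)))"
  have "(\<Sum>k=1..K. sharp_summand w n (?x k)) = (\<Sum>k=1..K. w 0 / n * ?x k + ?s k)"
    by (intro sum.cong refl) (auto simp: sharp_summand_def distrib_left)
  also have "\<dots> = w 0 / n * (\<Sum>k=1..K. real (?x k)) + (\<Sum>k=1..K. ?s k)"
    by (simp only: sum.distrib sum_distrib_left)
  also have "w 0 / n * (\<Sum>k=1..K. real (?x k)) = w 0"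
    using n sum_letter_count_eq[OF \<omega>] by simp
  finally show ?thesis
    unfolding theta_sharp_def Let_def rel_freq_def by (rule sym)
qed

lemma letter_count_le: "letter_count X l n k \<omega> \<le> n"
proof -
  have "letter_count X l n k \<omega> \<le> (\<Sum>i=1..n. 1)"
    unfolding letter_count_def by (intro sum_mono) auto
  then show ?thesis by simp
qed

lemma measurable_letter_count: "letter_count X l n k \<in> M \<rightarrow>\<^sub>M count_space UNIV"
proof -
  \<comment> \<open>Measurability is shown for the real-valued count and carried to the natural
    number by \<open>floor\<close>.\<close>
  have [measurable]: "(\<lambda>\<omega>. \<Sum>i=1..n. of_bool (X i \<omega> = l k) :: real) \<in> borel_measurable M"
    by (intro borel_measurable_sum measurable_fun_X) auto
  have "(\<lambda>\<omega>. nat \<lfloor>\<Sum>i=1..n. of_bool (X i \<omega> = l k) :: real\<rfloor>) \<in> M \<rightarrow>\<^sub>M count_space UNIV"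
    by measurable
  moreover have "nat \<lfloor>\<Sum>i=1..n. of_bool (X i \<omega> = l k) :: real\<rfloor> = letter_count X l n k \<omega>" for \<omega>
  proof -
    have "(\<Sum>i=1..n. of_bool (X i \<omega> = l k) :: real) = real (letter_count X l n k \<omega>)"
      by (simp add: letter_count_def)
    then show ?thesis by simp
  qed
  ultimately show ?thesis by simp
qed

lemma measurable_rel_freq [measurable]: "rel_freq X l n k \<in> borel_measurable M"
  unfolding rel_freq_def[abs_def] using measurable_letter_count[measurable] by measurable

lemma measurable_sharp_summand [measurable]:
  "(\<lambda>\<omega>. sharp_summand w n (letter_count X l n k \<omega>)) \<in> borel_measurable M"
  by (rule measurable_compose[OF measurable_letter_count]) simp

lemma rel_freq_deviation_integrable:
  assumes k: "k \<in> {1..K}"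
  shows "integrable M (\<lambda>\<omega>. (rel_freq X l n k \<omega> - p k)\<^sup>2)"
proof (rule integrable_bounded)
  fix \<omega>
  have "0 \<le> rel_freq X l n k \<omega>" "rel_freq X l n k \<omega> \<le> 1"
    using letter_count_le[of n k \<omega>] by (auto simp: rel_freq_def divide_le_eq)
  then have "\<bar>rel_freq X l n k \<omega> - p k\<bar> \<le> 1"
    using pos[OF k] p_less_1[OF k] by linarith
  then show "\<bar>(rel_freq X l n k \<omega> - p k)\<^sup>2\<bar> \<le> 1" by (simp add: abs_square_le_1)
qed measurable

text \<open>The deviation is \<open>1/n\<close> times a sum of \<open>n\<close> independent centred
  indicators bounded by 1, and such a sum has second moment at most \<open>n\<close>.\<close>

lemma rel_freq_deviation_second_moment:
  assumes k: "k \<in> {1..K}" and n: "n \<ge> 1"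
  shows "expectation (\<lambda>\<omega>. (rel_freq X l n k \<omega> - p k)\<^sup>2) \<le> 1 / n"
proof -
  define Z where "Z i \<omega> = (of_bool (X i \<omega> = l k) - p k :: real)" for i \<omega>
  have mean: "expectation (Z i) = 0" if "i \<ge> 1" for i
  proof -
    have "expectation (Z i) = (\<Sum>j=1..K. p j * (of_bool (l j = l k) - p k))"
      unfolding Z_def using expectation_fun_X[OF that, of "\<lambda>s. of_bool (s = l k) - p k"] by simp
    also have "\<dots> = (\<Sum>j=1..K. of_bool (l k = l j) * p j - p j * p k)"
      by (intro sum.cong refl) (auto simp: right_diff_distrib)
    also have "\<dots> = (\<Sum>j=1..K. of_bool (l k = l j) * p j) - (\<Sum>j=1..K. p j) * p k"
      by (simp only: sum_subtractf sum_distrib_right)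
    also have "(\<Sum>j=1..K. of_bool (l k = l j) * p j) = p k"
      using k by (intro sum_of_bool_label inj) auto
    finally show ?thesis using one by simp
  qed
  have ind: "indep_vars (\<lambda>_. borel) Z {1..n}"
    unfolding Z_def by (rule indep_vars_compose2[OF indep_vars_subset[OF indep]]) auto
  have "expectation (\<lambda>\<omega>. (\<Sum>i=1..n. Z i \<omega>)\<^sup>2) \<le> card {1..n}"
  proof (rule expectation_indep_sum_square[OF ind])
    show "\<bar>Z i \<omega>\<bar> \<le> 1" for i \<omega>
      using pos[OF k] p_less_1[OF k] by (cases "X i \<omega> = l k") (auto simp: Z_def)
  qed (use mean in auto)
  then have "expectation (\<lambda>\<omega>. (\<Sum>i=1..n. Z i \<omega>)\<^sup>2) / (real n)\<^sup>2 \<le> n / (real n)\<^sup>2"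
    by (intro divide_right_mono) auto
  also have "\<dots> = 1 / n" by (simp add: power2_eq_square)
  also have "expectation (\<lambda>\<omega>. (\<Sum>i=1..n. Z i \<omega>)\<^sup>2) / (real n)\<^sup>2 =
      expectation (\<lambda>\<omega>. (rel_freq X l n k \<omega> - p k)\<^sup>2)"
  proof -
    have "rel_freq X l n k \<omega> - p k = (\<Sum>i=1..n. Z i \<omega>) / n" for \<omega>
      using n by (simp add: Z_def sum_subtractf rel_freq_def letter_count_def diff_divide_distrib)
    then show ?thesis by (simp add: power_divide)
  qed
  finally show ?thesis .
qed

lemma remainder_negligible:
  assumes bnd: "\<And>v. \<bar>w v\<bar> \<le> B" and k: "k \<in> {1..K}" and c: "c > 0"
  shows "(\<lambda>n. expectation (\<lambda>\<omega>. min 1 \<bar>sqrt n * (c * (sharp_summand w n (letter_count X l n k \<omega>)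
    - p k * h_fun w (p k) - influence w (p k) * (rel_freq X l n k \<omega> - p k)))\<bar>)) \<longlonglongrightarrow> 0"
proof (rule delta_method_remainder[where D = "\<lambda>n \<omega>. rel_freq X l n k \<omega> - p k"])
  fix e :: real assume "e > 0"
  \<comment> \<open>Linearizing with \<open>e / c\<close> compensates for the later multiplication
    by \<open>c\<close>.\<close>
  then obtain d C N where d: "d > 0" "C \<ge> 0" and N: "\<And>n x. n \<ge> N \<Longrightarrow> \<bar>real x / n - p k\<bar> < d \<Longrightarrow>
      \<bar>sharp_summand w n x - p k * h_fun w (p k) - influence w (p k) * (real x / n - p k)\<bar>
      \<le> e / c * \<bar>real x / n - p k\<bar> + C / n"
    using sharp_summand_linearization[of w B "p k" "e / c"] bnd pos[OF k] p_less_1[OF k] c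
    by (metis divide_pos_pos)
  have main: "\<bar>c * (sharp_summand w n x - p k * h_fun w (p k) - influence w (p k) * (real x / n - p k))\<bar>
      \<le> e * \<bar>real x / n - p k\<bar> + c * C / n"
    if "n \<ge> N" "\<bar>real x / n - p k\<bar> < d" for n x
  proof -
    have "c * \<bar>sharp_summand w n x - p k * h_fun w (p k) - influence w (p k) * (real x / n - p k)\<bar>
        \<le> c * (e / c * \<bar>real x / n - p k\<bar> + C / n)"
      using N[OF that] c by (intro mult_left_mono) auto
    also have "\<dots> = e * \<bar>real x / n - p k\<bar> + c * C / n"
      using c by (simp add: distrib_left)
    finally show ?thesis using c by (simp only: abs_mult abs_of_pos)
  qed
  show "\<exists>d>0. \<exists>C\<ge>0. \<exists>N. \<forall>n\<ge>N. \<forall>\<omega>\<in>space M. \<bar>rel_freq X l n k \<omega> - p k\<bar> < d \<longrightarrow>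
      \<bar>c * (sharp_summand w n (letter_count X l n k \<omega>)
        - p k * h_fun w (p k) - influence w (p k) * (rel_freq X l n k \<omega> - p k))\<bar>
      \<le> e * \<bar>rel_freq X l n k \<omega> - p k\<bar> + C / n"
    by (rule exI[of _ d], rule conjI[OF d(1)], rule exI[of _ "c * C"], rule conjI, use c d in simp,
        rule exI[of _ N]) (use main in \<open>auto simp: rel_freq_def\<close>)
qed (use k rel_freq_deviation_integrable rel_freq_deviation_second_moment in auto)

text \<open>The scores \<open>a k\<close> are realized as a function of the letter, so
  \<open>expectation_fun_X\<close> yields their mean \<open>m\<close> and second moment, and
  \<open>V\<close> is their variance.\<close>

lemma clt_letter_scores:
  fixes a :: "nat \<Rightarrow> real" and \<phi> :: "'a \<Rightarrow> real" and m V :: real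
  defines "\<phi> \<equiv> \<lambda>s. \<Sum>k=1..K. of_bool (s = l k) * a k"
    and "m \<equiv> \<Sum>k=1..K. p k * a k" and "V \<equiv> (\<Sum>k=1..K. p k * (a k)\<^sup>2) - (\<Sum>k=1..K. p k * a k)\<^sup>2"
  assumes V: "V > 0"
  shows "weak_conv_m (\<lambda>n. distr M borel (\<lambda>\<omega>. (\<Sum>i<n. \<phi> (X (Suc i) \<omega>) - m) / sqrt (n * V)))
    std_normal_distribution"
proof -
  let ?N = "count_space (l ` {1..K})"
  have \<phi>: "\<phi> (l k) = a k" if "k \<in> {1..K}" for k
    unfolding \<phi>_def using that by (intro sum_of_bool_label inj) auto
  have E1: "expectation (\<lambda>\<omega>. \<phi> (X (Suc i) \<omega>)) = m" for i
    using expectation_fun_X[of "Suc i" \<phi>] \<phi> by (simp add: m_def)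
  have E2: "expectation (\<lambda>\<omega>. (\<phi> (X (Suc i) \<omega>))\<^sup>2) = (\<Sum>k=1..K. p k * (a k)\<^sup>2)" for i
    using expectation_fun_X[of "Suc i" "\<lambda>s. (\<phi> s)\<^sup>2"] \<phi> by simp
  have int: "integrable M (\<lambda>\<omega>. g (X (Suc i) \<omega>))" for g :: "'a \<Rightarrow> real" and i
    by (rule integrable_finite_range[OF measurable_X]) auto
  have "range Suc = {1..}"
    by (auto simp: image_iff) (metis Suc_le_D)
  then have "indep_vars (\<lambda>_. ?N) (\<lambda>i. X (Suc i)) UNIV"
    using indep_vars_reindex[of "\<lambda>_. ?N" X Suc UNIV] indep by simp
  then have ind: "indep_vars (\<lambda>_. borel) (\<lambda>i \<omega>. \<phi> (X (Suc i) \<omega>)) UNIV"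
    by (rule indep_vars_compose2) auto
  \<comment> \<open>The central limit theorem asks for one common law: the image under the score
    function of the law of \<open>X 1\<close>.\<close>
  have dist: "distr M borel (\<lambda>\<omega>. \<phi> (X (Suc i) \<omega>)) = distr (distr M ?N (X 1)) borel \<phi>" for i
  proof -
    have "distr M borel (\<lambda>\<omega>. \<phi> (X (Suc i) \<omega>)) = distr (distr M ?N (X (Suc i))) borel \<phi>"
      using distr_distr[of \<phi> ?N borel "X (Suc i)" M] measurable_X[of "Suc i"] by (simp add: comp_def)
    then show ?thesis using ident[of "Suc i"] by simp
  qed
  have var: "variance (\<lambda>\<omega>. \<phi> (X (Suc i) \<omega>)) = (sqrt V)\<^sup>2" for i
    using V by (subst variance_eq) (simp_all add: int E1 E2 V_def m_def int[of "\<lambda>s. (\<phi> s)\<^sup>2"])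
  have "weak_conv_m (\<lambda>n. distr M borel (\<lambda>\<omega>. (\<Sum>i<n. \<phi> (X (Suc i) \<omega>) - m) / sqrt (n * (sqrt V)\<^sup>2)))
      std_normal_distribution"
    by (rule central_limit_theorem[OF ind E1 _ int[of "\<lambda>s. (\<phi> s)\<^sup>2"] var dist]) (use V in simp)
  then show ?thesis using V by simp
qed

end

section \<open>Normal limit of the estimator from its linear part and its remainders\<close>

theorem theorem2:
  fixes M :: "'b measure"
    and X :: "nat \<Rightarrow> 'b \<Rightarrow> 'a"
    and l :: "nat \<Rightarrow> 'a"
    and p w :: "nat \<Rightarrow> real"
    and K :: nat
    and B :: real
  assumes "prob_space M"
    and "inj_on l {1..K}"
    and "\<And>k. k \<in> {1..K} \<Longrightarrow> p k > 0"
    and "(\<Sum>k=1..K. p k) = 1"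
    and "B > 0"
    and "\<And>v. \<bar>w v\<bar> \<le> B"
    and "prob_space.indep_vars M (\<lambda>_. count_space (l ` {1..K})) X {1..}"
    and "\<And>i. i \<ge> 1 \<Longrightarrow>
           distr M (count_space (l ` {1..K})) (X i) = distr M (count_space (l ` {1..K})) (X 1)"
    and "\<And>k. k \<in> {1..K} \<Longrightarrow> measure M {\<omega> \<in> space M. X 1 \<omega> = l k} = p k"
    and "asymp_var w K (restrict p {1..K-1}) > 0"
  shows "weak_conv_m
    (\<lambda>n. distr M borel (\<lambda>\<omega>. sqrt (real n) * (theta_sharp w K X l n \<omega> - theta w K p)
            * asymp_var w K (restrict p {1..K-1}) powr (- 1 / 2)))
    std_normal_distribution"
proof -
  define V where "V = asymp_var w K (restrict p {1..K-1})"
  have V: "V > 0" using assms(10) by (simp add: V_def)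
  have K2: "K \<ge> 2"
  proof (rule ccontr)
    assume "\<not> K \<ge> 2"
    \<comment> \<open>The quadratic form is then an empty sum, which contradicts positivity.\<close>
    then have "K - 1 = 0" by simp
    then show False using assms(10) by (simp add: asymp_var_def quad_form_def)
  qed
  interpret prob_space M by fact
  interpret letter_sample M X l p K
    by (intro letter_sample.intro letter_sample_axioms.intro) (fact assms K2)+
  define a where "a k = influence w (p k)" for k
  define m where "m = (\<Sum>k=1..K. p k * a k)"
  define \<phi> where "\<phi> s = (\<Sum>k=1..K. of_bool (s = l k) * a k)" for s
  define c where "c = V powr (- 1 / 2)"
  define D where "D n k \<omega> = rel_freq X l n k \<omega> - p k" for n k \<omega>
  \<comment> \<open>Normalized error of the \<open>k\<close>-th summand after removal of its value
    and its linear term at \<open>p k\<close>.\<close>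
  define R where "R k n \<omega> = sqrt n * (c * (sharp_summand w n (letter_count X l n k \<omega>)
    - p k * h_fun w (p k) - a k * D n k \<omega>))" for k n \<omega>
  have "c = V powr - (1 / 2)" by (simp add: c_def)
  also have "\<dots> = 1 / sqrt V"
    using V by (simp only: powr_minus_divide powr_half_sqrt less_imp_le)
  finally have c: "c > 0" "c = 1 / sqrt V" using V by simp_all
  have V_eq: "V = (\<Sum>k=1..K. p k * (a k)\<^sup>2) - (\<Sum>k=1..K. p k * a k)\<^sup>2"
    unfolding V_def a_def by (rule asymp_var_eq[of w B]) (use assms(3,4,6) K2 in auto)
  have clt: "weak_conv_m (\<lambda>n. distr M borel (\<lambda>\<omega>. (\<Sum>i<n. \<phi> (X (Suc i) \<omega>) - m) / sqrt (n * V)))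
      std_normal_distribution"
    using clt_letter_scores[of a] V unfolding V_eq m_def \<phi>_def by simp
  have "weak_conv_m (\<lambda>n. distr M borel (\<lambda>\<omega>. (\<Sum>i<n. \<phi> (X (Suc i) \<omega>) - m) / sqrt (n * V)
      + (\<Sum>k=1..K. R k n \<omega>))) std_normal_distribution"
  proof (rule weak_conv_m_add_negligible[OF _ _ real_dist_normal_dist clt])
    have [measurable]: "(\<lambda>\<omega>. \<phi> (X (Suc i) \<omega>)) \<in> borel_measurable M" for i
      by (rule measurable_fun_X) simp
    show "(\<lambda>\<omega>. (\<Sum>i<n. \<phi> (X (Suc i) \<omega>) - m) / sqrt (n * V)) \<in> borel_measurable M" for n
      by measurable
    have [measurable]: "R k n \<in> borel_measurable M" for k n
      unfolding R_def[abs_def] D_def by measurable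
    show "(\<lambda>\<omega>. \<Sum>k=1..K. R k n \<omega>) \<in> borel_measurable M" for n by measurable
    show "(\<lambda>n. expectation (\<lambda>\<omega>. min 1 \<bar>\<Sum>k=1..K. R k n \<omega>\<bar>)) \<longlonglongrightarrow> 0"
    proof (rule truncated_mean_sum_tendsto_0)
      show "(\<lambda>n. expectation (\<lambda>\<omega>. min 1 \<bar>R k n \<omega>\<bar>)) \<longlonglongrightarrow> 0" if "k \<in> {1..K}" for k
        using remainder_negligible[of w B k c] assms(6) that c(1) by (simp add: R_def D_def a_def)
    qed auto
  qed
  also have "(\<lambda>n. distr M borel (\<lambda>\<omega>. (\<Sum>i<n. \<phi> (X (Suc i) \<omega>) - m) / sqrt (n * V) + (\<Sum>k=1..K. R k n \<omega>))) =
      (\<lambda>n. distr M borel (\<lambda>\<omega>. sqrt (real n) * (theta_sharp w K X l n \<omega> - theta w K p) * c))"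
  proof (intro ext distr_cong refl)
    fix n \<omega> assume \<omega>: "\<omega> \<in> space M"
    show "(\<Sum>i<n. \<phi> (X (Suc i) \<omega>) - m) / sqrt (n * V) + (\<Sum>k=1..K. R k n \<omega>) =
        sqrt (real n) * (theta_sharp w K X l n \<omega> - theta w K p) * c"
    \<comment> \<open>The decomposition is an exact identity for every \<open>n\<close>. At
      \<open>n = 0\<close> both sides vanish, through the empty sum and
      \<open>sqrt 0\<close>.\<close>
    proof (cases "n = 0")
      case True
      then show ?thesis by (simp add: R_def)
    next
      case False
      \<comment> \<open>Centring the scores by \<open>m\<close> amounts to centring each count by
        \<open>n * p k\<close>.\<close>
      have "(\<Sum>i<n. \<phi> (X (Suc i) \<omega>) - m) = (\<Sum>k=1..K. real (letter_count X l n k \<omega>) * a k) - n * m"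
        by (subst sum_letter_count[OF \<omega>]) (simp add: \<phi>_def sum_subtractf)
      also have "\<dots> = n * (\<Sum>k=1..K. a k * D n k \<omega>)"
        using False by (simp add: D_def rel_freq_def m_def sum_distrib_left sum_subtractf[symmetric] algebra_simps)
      finally have "(\<Sum>i<n. \<phi> (X (Suc i) \<omega>) - m) / sqrt (n * V) = n * (\<Sum>k=1..K. a k * D n k \<omega>) / sqrt (n * V)"
        by simp
      also have "\<dots> = (n / sqrt n) * c * (\<Sum>k=1..K. a k * D n k \<omega>)"
        using c(2) by (simp add: real_sqrt_mult)
      also have "n / sqrt n = sqrt n" by (rule real_div_sqrt) simp
      finally have lin: "(\<Sum>i<n. \<phi> (X (Suc i) \<omega>) - m) / sqrt (n * V) = sqrt n * c * (\<Sum>k=1..K. a k * D n k \<omega>)" .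
      have "theta w K p = (\<Sum>k=1..K. p k * h_fun w (p k))"
        by (rule theta_eq[of w B]) (use assms(6) pos p_less_1 in auto)
      moreover have "theta_sharp w K X l n \<omega> = (\<Sum>k=1..K. sharp_summand w n (letter_count X l n k \<omega>))"
        by (rule theta_sharp_eq) (use \<omega> False in auto)
      \<comment> \<open>On summation the linear terms cancel those of \<open>lin\<close>, and what
        remains is the estimator minus \<open>theta\<close>.\<close>
      moreover have "(\<Sum>k=1..K. R k n \<omega>) = sqrt n * c * ((\<Sum>k=1..K. sharp_summand w n (letter_count X l n k \<omega>))
          - (\<Sum>k=1..K. p k * h_fun w (p k)) - (\<Sum>k=1..K. a k * D n k \<omega>))"
        by (simp add: R_def sum_distrib_left sum_subtractf[symmetric] mult.assoc)
      ultimately show ?thesis unfolding lin by (simp add: algebra_simps)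
    qed
  qed
  finally show ?thesis unfolding c_def V_def .
qed

end
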